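(* Let $(S,A,d,P)$ be a finite-horizon Markov decision process of horizon $T$ with non-negative danger function $d$, let $\beta\in[0,1)$, let $\mathbf{x}=(x_0,\dots,x_T)$ be non-negative constants, let $\eta$ be a policy (the baseline policy), and let $\pi\in\Pi^{\eta,\mathbf{x}}$ be an $(\eta,\mathbf{x})$-secure policy. Let $s_0\in S$ be an initial state such that $\mathscr{T}_0^{\eta}(s_0,a)\le x_0$ for all $a\in A$. Then $$\mathscr{T}_0^{\pi}(s_0)\;\le\; x_0+\sum_{t=1}^{T-1}\beta^t\,x_t\,E_{\pi}\bigl[z_t(s_{t-1},a_{t-1})\,\big|\,s_0\bigr],$$ where $$z_t(s_{t-1},a_{t-1})=E\Bigl[\mathbf{1}_{\{s_t\in S^{\eta,\mathbf{x}}\}}\;d_{TV}\bigl(\pi(\cdot|s_t),\eta(\cdot|s_t)\bigr)\,\Big|\,s_{t-1},a_{t-1}\Bigr].$$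
   Context: Setting: a discrete-time Markov decision process with horizon $T$. $S$ is the set of states, $A$ is the (discrete) set of actions, $P(s,a,s')$ is the probability (density) of the transition from $s$ to $s'$ under action $a$, and $d(s,a)\ge 0$ is the danger of taking action $a$ at state $s$; write $d_{t+1}=d(s_t,a_t)$. A policy $\pi$ assigns to each state $s$ a probability distribution $\pi(\cdot|s)$ on $A$. $E_\pi$ denotes expectation when actions are drawn from $\pi$ and states evolve by $P$; $E[\,\cdot\mid s_{t-1},a_{t-1}]$ is expectation over $s_t\sim P(s_{t-1},a_{t-1},\cdot)$. Threat function: for a policy $\eta$ and $t\in\{0,\dots,T\}$, $$\mathscr{T}_t^{\eta}(s,a)=E_\eta\Bigl[\sum_{k=t+1}^{T}\beta^{k-t}d_k\,\Big|\,s_t=s,\ a_t=a\Bigr]$$ (the empty sum for $t=T$ is $0$), and $\mathscr{T}_0^{\pi}(s_0)=E_{\pi}[\mathscr{T}_0^{\pi}(s_0,a_0)\mid s_0]$, with $a_0\sim\pi(\cdot|s_0)$. Secure actions and states: $A^{\eta,\mathbf{x}}(s)=\bigcap_{t=0}^{T}\{a\in A:\mathscr{T}_t^{\eta}(s,a)\le x_t\}$ and $S^{\eta,\mathbf{x}}=\{s\in S: A^{\eta,\mathbf{x}}(s)\ne\emptyset\}$. For $s\in S$, let $\mathcal{F}^{\eta}(s)$ be the set of probability distributions $p(\cdot|s)$ on $A$ such that $E_{a\sim p(\cdot|s)}[\mathscr{T}_t^{\eta}(s,a)]\le E_{a\sim\eta(\cdot|s)}[\mathscr{T}_t^{\eta}(s,a)]$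 for all $t\in\{0,\dots,T\}$. Secure policies: $\Pi^{\eta,\mathbf{x}}$ is the set of policies $\pi$ such that $\mathrm{supp}\,\pi(\cdot|s)\subseteq A^{\eta,\mathbf{x}}(s)$ for every $s\in S^{\eta,\mathbf{x}}$, and $\pi(\cdot|s)\in\mathcal{F}^{\eta}(s)$ for every $s\notin S^{\eta,\mathbf{x}}$. Total variation distance: $d_{TV}(p,q)=\tfrac12\sum_{a}|p(a)-q(a)|$. *)

theory Defs
  imports "HOL-Probability.Probability"
begin

text \<open>
  The state space is the measurable space \<open>states D\<close> and the transition law is a Markov kernel on
  it; discrete state spaces (transition probabilities) and transition densities with respect to a
  reference measure are both instances. The action set is a countable type with the discrete
  sigma-algebra.
\<close>

record ('s, 'a) mdp =
  states :: "'s measure"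
  trans_kernel :: "'s \<Rightarrow> 'a \<Rightarrow> 's measure"
  danger :: "'s \<Rightarrow> 'a \<Rightarrow> real"
  horizon :: nat

definition state_actions :: "('s, 'a, 'b) mdp_scheme \<Rightarrow> ('s \<times> 'a) measure" where
  "state_actions D = states D \<Otimes>\<^sub>M count_space UNIV"

definition is_mdp :: "('s, 'a::countable) mdp \<Rightarrow> bool" where
  "is_mdp D \<longleftrightarrow>
     (\<lambda>(s, a). trans_kernel D s a) \<in> state_actions D \<rightarrow>\<^sub>M prob_algebra (states D) \<and>
     (\<lambda>(s, a). danger D s a) \<in> borel_measurable (state_actions D) \<and>
     (\<forall>s\<in>space (states D). \<forall>a. 0 \<le> danger D s a)"

definition policies :: "('s, 'a::countable) mdp \<Rightarrow> ('s \<Rightarrow> 'a pmf) set" where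
  "policies D = {\<pi>. (\<lambda>s. measure_pmf (\<pi> s)) \<in> states D \<rightarrow>\<^sub>M prob_algebra (count_space UNIV)}"

definition draw_action ::
  "('s, 'a::countable) mdp \<Rightarrow> ('s \<Rightarrow> 'a pmf) \<Rightarrow> 's \<Rightarrow> ('s \<times> 'a) measure" where
  "draw_action D \<pi> s = distr (measure_pmf (\<pi> s)) (state_actions D) (\<lambda>a. (s, a))"

definition step ::
  "('s, 'a::countable) mdp \<Rightarrow> ('s \<Rightarrow> 'a pmf) \<Rightarrow> 's \<Rightarrow> 'a \<Rightarrow> ('s \<times> 'a) measure" where
  "step D \<pi> s a = trans_kernel D s a \<bind> draw_action D \<pi>"

text \<open>
  Law of the path \<open>\<omega> 0, \<dots>, \<omega> n\<close> of state-action pairs generated by the policy, where \<open>\<omega> 0\<close> has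
  law \<open>\<mu>\<close>. It is the Ionescu-Tulcea composition of the kernels \<open>path_kernel D \<pi> \<mu> i\<close>, which map
  the history \<open>\<omega> 0, \<dots>, \<omega> (i - 1)\<close> to the conditional law of \<open>\<omega> i\<close>.
\<close>

definition path_kernel ::
  "('s, 'a::countable) mdp \<Rightarrow> ('s \<Rightarrow> 'a pmf) \<Rightarrow> ('s \<times> 'a) measure \<Rightarrow>
    nat \<Rightarrow> (nat \<Rightarrow> 's \<times> 'a) \<Rightarrow> ('s \<times> 'a) measure" where
  "path_kernel D \<pi> \<mu> i \<omega> = (if i = 0 then \<mu> else case \<omega> (i - 1) of (s, a) \<Rightarrow> step D \<pi> s a)"

definition path_law ::
  "('s, 'a::countable) mdp \<Rightarrow> ('s \<Rightarrow> 'a pmf) \<Rightarrow> ('s \<times> 'a) measure \<Rightarrow> nat \<Rightarrow>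
    (nat \<Rightarrow> 's \<times> 'a) measure" where
  "path_law D \<pi> \<mu> n =
     Ionescu_Tulcea.C (path_kernel D \<pi> \<mu>) (\<lambda>_. state_actions D) 0 (Suc n) (\<lambda>_. undefined)"

text \<open>
  The dynamics and the policy do not depend on time, so the process conditioned on being in state
  \<open>s\<close> and taking action \<open>a\<close> at time \<open>t\<close> is the path started from \<open>(s, a)\<close>, with \<open>\<omega> i\<close> the
  state-action pair at time \<open>t + i\<close>. Accordingly the danger \<open>d_k\<close>, incurred by the pair of time
  \<open>k - 1\<close>, is read off at \<open>\<omega> (k - 1 - t)\<close>. Expectations of non-negative quantities take values in
  the extended non-negative reals, so no integrability of the danger is presupposed.
\<close>

definition threat ::
  "('s, 'a::countable) mdp \<Rightarrow> real \<Rightarrow> ('s \<Rightarrow> 'a pmf) \<Rightarrow> nat \<Rightarrow> 's \<Rightarrow> 'a \<Rightarrow> ennreal" where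
  "threat D \<beta> \<eta> t s a =
     (\<integral>\<^sup>+ \<omega>. (\<Sum>k=t+1..horizon D. ennreal (\<beta> ^ (k - t) * case_prod (danger D) (\<omega> (k - 1 - t))))
        \<partial>path_law D \<eta> (return (state_actions D) (s, a)) (horizon D - t))"

definition initial_threat ::
  "('s, 'a::countable) mdp \<Rightarrow> real \<Rightarrow> ('s \<Rightarrow> 'a pmf) \<Rightarrow> 's \<Rightarrow> ennreal" where
  "initial_threat D \<beta> \<pi> s = (\<integral>\<^sup>+ a. threat D \<beta> \<pi> 0 s a \<partial>measure_pmf (\<pi> s))"

definition secure_actions ::
  "('s, 'a::countable) mdp \<Rightarrow> real \<Rightarrow> ('s \<Rightarrow> 'a pmf) \<Rightarrow> (nat \<Rightarrow> real) \<Rightarrow> 's \<Rightarrow> 'a set" where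
  "secure_actions D \<beta> \<eta> x s = (\<Inter>t\<in>{0..horizon D}. {a. threat D \<beta> \<eta> t s a \<le> ennreal (x t)})"

definition secure_states ::
  "('s, 'a::countable) mdp \<Rightarrow> real \<Rightarrow> ('s \<Rightarrow> 'a pmf) \<Rightarrow> (nat \<Rightarrow> real) \<Rightarrow> 's set" where
  "secure_states D \<beta> \<eta> x = {s \<in> space (states D). secure_actions D \<beta> \<eta> x s \<noteq> {}}"

definition no_riskier_dists ::
  "('s, 'a::countable) mdp \<Rightarrow> real \<Rightarrow> ('s \<Rightarrow> 'a pmf) \<Rightarrow> 's \<Rightarrow> 'a pmf set" where
  "no_riskier_dists D \<beta> \<eta> s =
     {p. \<forall>t\<in>{0..horizon D}. (\<integral>\<^sup>+ a. threat D \<beta> \<eta> t s a \<partial>measure_pmf p)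
                           \<le> (\<integral>\<^sup>+ a. threat D \<beta> \<eta> t s a \<partial>measure_pmf (\<eta> s))}"

definition secure_policies ::
  "('s, 'a::countable) mdp \<Rightarrow> real \<Rightarrow> ('s \<Rightarrow> 'a pmf) \<Rightarrow> (nat \<Rightarrow> real) \<Rightarrow> ('s \<Rightarrow> 'a pmf) set" where
  "secure_policies D \<beta> \<eta> x =
     {\<pi> \<in> policies D.
        (\<forall>s\<in>secure_states D \<beta> \<eta> x. set_pmf (\<pi> s) \<subseteq> secure_actions D \<beta> \<eta> x s) \<and>
        (\<forall>s\<in>space (states D) - secure_states D \<beta> \<eta> x. \<pi> s \<in> no_riskier_dists D \<beta> \<eta> s)}"

definition tv_dist :: "'a pmf \<Rightarrow> 'a pmf \<Rightarrow> real" where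
  "tv_dist p q = 1/2 * (\<Sum>\<^sub>\<infinity>a\<in>UNIV. \<bar>pmf p a - pmf q a\<bar>)"

definition secure_deviation ::
  "('s, 'a::countable) mdp \<Rightarrow> real \<Rightarrow> ('s \<Rightarrow> 'a pmf) \<Rightarrow> (nat \<Rightarrow> real) \<Rightarrow> ('s \<Rightarrow> 'a pmf) \<Rightarrow>
    's \<Rightarrow> 'a \<Rightarrow> ennreal" where
  "secure_deviation D \<beta> \<eta> x \<pi> s a =
     (\<integral>\<^sup>+ s'. indicator (secure_states D \<beta> \<eta> x) s' * ennreal (tv_dist (\<pi> s') (\<eta> s'))
        \<partial>trans_kernel D s a)"

text \<open>The library's path construction applies to every MDP, policy and initial law.\<close>

lemma measurable_draw_action:
  assumes "\<pi> \<in> policies D"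
  shows "draw_action D \<pi> \<in> states D \<rightarrow>\<^sub>M prob_algebra (state_actions D)"
proof -
  have [measurable]: "(\<lambda>s. measure_pmf (\<pi> s)) \<in> states D \<rightarrow>\<^sub>M prob_algebra (count_space UNIV)"
    using assms by (simp add: policies_def)
  show ?thesis
    unfolding draw_action_def[abs_def]
    by (rule measurable_distr_prob_space2[where M = "count_space UNIV"])
      (auto simp: state_actions_def)
qed

lemma measurable_step:
  assumes "is_mdp D" "\<pi> \<in> policies D"
  shows "(\<lambda>(s, a). step D \<pi> s a) \<in> state_actions D \<rightarrow>\<^sub>M prob_algebra (state_actions D)"
proof -
  have "(\<lambda>(s, a). trans_kernel D s a) \<in> state_actions D \<rightarrow>\<^sub>M prob_algebra (states D)"
    using assms(1) by (simp add: is_mdp_def)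
  from measurable_bind_prob_space[OF this measurable_draw_action[OF assms(2)]]
  show ?thesis
    by (simp add: step_def split_beta')
qed

lemma Ionescu_Tulcea_path_kernel:
  assumes "is_mdp D" "\<pi> \<in> policies D" "\<mu> \<in> space (prob_algebra (state_actions D))"
  shows "Ionescu_Tulcea (path_kernel D \<pi> \<mu>) (\<lambda>_. state_actions D)"
proof -
  have *: "path_kernel D \<pi> \<mu> i \<in> PiM {0..<i} (\<lambda>_. state_actions D) \<rightarrow>\<^sub>M prob_algebra (state_actions D)" for i
  proof (cases "i = 0")
    case True
    then show ?thesis
      using assms(3) by (simp add: path_kernel_def[abs_def])
  next
    case False
    then have "(\<lambda>\<omega>. \<omega> (i - 1)) \<in> PiM {0..<i} (\<lambda>_. state_actions D) \<rightarrow>\<^sub>M state_actions D"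
      by (intro measurable_component_singleton) auto
    from measurable_compose[OF this measurable_step[OF assms(1,2)]] False show ?thesis
      by (simp add: path_kernel_def[abs_def])
  qed
  show ?thesis
    unfolding Ionescu_Tulcea_def
    using measurable_prob_algebraD[OF *] measurable_space[OF *]
    by (auto simp: space_prob_algebra)
qed

end

theory Submission
  imports Defs
begin

text \<open>
  Let \<open>K\<close> be the transition operator of a policy on functions of a state-action pair. The
  threat with \<open>n\<close> steps to go is \<open>\<Sum>i<n. \<beta>^(i+1) K\<^sup>i d\<close>, so it satisfies
  \<open>T\<^sub>n\<^sub>+\<^sub>1 = \<beta> (d + K T\<^sub>n)\<close>, and the threats of \<open>\<pi>\<close> and \<open>\<eta>\<close> are compared by induction on \<open>n\<close>.
  The error made in a step by drawing the next action from \<open>\<pi>\<close> instead of \<open>\<eta>\<close> vanishes at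
  insecure states. At a secure state \<open>s\<close> it is at most
  \<open>\<Sum>a. (\<pi> a - \<eta> a)\<^sup>+ T(s, a) \<le> x\<^sub>t d\<^sub>T\<^sub>V(\<pi>, \<eta>)\<close>, because \<open>\<pi>\<close> only charges actions with
  \<open>T \<le> x\<^sub>t\<close>.
\<close>

section \<open>Total variation distance\<close>

text \<open>Both mass functions have total 1 and share the part
  \<open>min (pmf p a) (pmf q a)\<close>, so the positive parts of p - q and of q - p have equal
  sums, and half the l1 distance equals either one. As \<open>ennreal\<close> sends negative reals
  to 0, \<open>ennreal (pmf p a - pmf q a)\<close> is the positive part.\<close>

lemma ennreal_tv_dist:
  fixes p q :: "'a pmf"
  shows "ennreal (tv_dist p q) = (\<integral>\<^sup>+ a. ennreal (pmf p a - pmf q a) \<partial>count_space UNIV)"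
proof -
  let ?I = "\<lambda>f :: 'a \<Rightarrow> real. \<integral>\<^sup>+ a. ennreal (f a) \<partial>count_space UNIV"
  have split: "?I (\<lambda>a. pmf p a - pmf q a) + ?I (\<lambda>a. min (pmf p a) (pmf q a)) = 1" for p q :: "'a pmf"
  proof -
    have "?I (\<lambda>a. pmf p a - pmf q a) + ?I (\<lambda>a. min (pmf p a) (pmf q a)) = ?I (pmf p)"
      by (subst nn_integral_add[symmetric])
        (auto intro!: nn_integral_cong simp: min_def ennreal_neg simp flip: ennreal_plus)
    then show ?thesis
      by (simp add: nn_integral_pmf measure_pmf.emeasure_space_1[simplified])
  qed
  have "?I (\<lambda>a. min (pmf p a) (pmf q a)) \<le> 1"
    using split[of p q] by (metis add.commute le_iff_add)
  \<comment> \<open>Only a finite summand can be cancelled in \<open>ennreal\<close>.\<close>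
  then have "?I (\<lambda>a. min (pmf p a) (pmf q a)) \<noteq> \<top>"
    by (auto simp: top_unique)
  moreover have "?I (\<lambda>a. min (pmf p a) (pmf q a)) + ?I (\<lambda>a. pmf q a - pmf p a) =
      ?I (\<lambda>a. min (pmf p a) (pmf q a)) + ?I (\<lambda>a. pmf p a - pmf q a)"
    using split[of p q] split[of q p] by (simp only: min.commute[of "pmf q _"] add.commute)
  ultimately have sym: "?I (\<lambda>a. pmf q a - pmf p a) = ?I (\<lambda>a. pmf p a - pmf q a)"
    unfolding ennreal_add_left_cancel infinity_ennreal_def by blast
  \<comment> \<open>Absolute summability turns the real infinite sum of \<open>tv_dist\<close> into
    an integral over the counting measure, by way of \<open>infsetsum\<close>.\<close>
  have "Infinite_Set_Sum.abs_summable_on (\<lambda>a. norm (pmf p a - pmf q a)) UNIV"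
    unfolding abs_summable_on_norm_iff
    by (intro Infinite_Set_Sum.abs_summable_on_diff pmf_abs_summable)
  then have summable: "Infinite_Set_Sum.abs_summable_on (\<lambda>a. \<bar>pmf p a - pmf q a\<bar>) UNIV"
    by (simp only: real_norm_def)
  have "ennreal (\<Sum>\<^sub>\<infinity>a. \<bar>pmf p a - pmf q a\<bar>) = ?I (\<lambda>a. \<bar>pmf p a - pmf q a\<bar>)"
    unfolding infsetsum_infsum[OF summable, symmetric]
    by (rule nn_integral_conv_infsetsum[OF summable, symmetric]) simp
  also have "\<dots> = ?I (\<lambda>a. pmf p a - pmf q a) + ?I (\<lambda>a. pmf q a - pmf p a)"
    by (subst nn_integral_add[symmetric]) (auto intro!: nn_integral_cong simp: abs_if ennreal_neg)
  also have "\<dots> = 2 * ?I (\<lambda>a. pmf p a - pmf q a)"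
    by (simp add: sym mult_2)
  finally have abs_sum: "ennreal (\<Sum>\<^sub>\<infinity>a. \<bar>pmf p a - pmf q a\<bar>) = 2 * ?I (\<lambda>a. pmf p a - pmf q a)" .
  have "ennreal (tv_dist p q) = ennreal (1/2) * (ennreal 2 * ?I (\<lambda>a. pmf p a - pmf q a))"
    unfolding tv_dist_def
    by (rule trans[OF ennreal_mult']) (simp, simp only: abs_sum ennreal_numeral)
  also have "\<dots> = ennreal (1/2 * 2) * ?I (\<lambda>a. pmf p a - pmf q a)"
    unfolding mult.assoc[symmetric]
    by (rule arg_cong[where f = "\<lambda>c. c * _"], rule ennreal_mult'[symmetric]) simp
  finally show ?thesis
    by simp
qed

text \<open>Where p exceeds q, the action lies in the support of p, so each unit of excess mass
  costs at most c; elsewhere the mass of q already dominates. Off the support of p, the function may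
  be arbitrarily large, as threats of non-secure actions can be.\<close>

lemma nn_integral_pmf_le_tv_dist:
  fixes p q :: "'a pmf"
  assumes "\<And>a. a \<in> set_pmf p \<Longrightarrow> f a \<le> c"
  shows "(\<integral>\<^sup>+ a. f a \<partial>p) \<le> (\<integral>\<^sup>+ a. f a \<partial>q) + c * ennreal (tv_dist p q)"
proof -
  have "ennreal (pmf p a) * f a \<le> ennreal (pmf q a) * f a + c * ennreal (pmf p a - pmf q a)" for a
  proof (cases "pmf p a \<le> pmf q a")
    case True
    then show ?thesis
      by (intro add_increasing2 mult_right_mono ennreal_leI) auto
  next
    case False
    then have "a \<in> set_pmf p"
      using pmf_nonneg[of q a] by (auto simp: set_pmf_iff simp del: pmf_nonneg)
    have "ennreal (pmf p a) = ennreal (pmf q a) + ennreal (pmf p a - pmf q a)"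
      using False by (simp flip: ennreal_plus)
    then have "ennreal (pmf p a) * f a = ennreal (pmf q a) * f a + f a * ennreal (pmf p a - pmf q a)"
      by (simp add: algebra_simps)
    with assms[OF \<open>a \<in> set_pmf p\<close>] show ?thesis
      by (auto intro!: mult_right_mono add_left_mono)
  qed
  then have "(\<integral>\<^sup>+ a. f a \<partial>p) \<le>
      (\<integral>\<^sup>+ a. ennreal (pmf q a) * f a + c * ennreal (pmf p a - pmf q a) \<partial>count_space UNIV)"
    unfolding nn_integral_measure_pmf by (intro nn_integral_mono)
  also have "\<dots> = (\<integral>\<^sup>+ a. f a \<partial>q) + c * ennreal (tv_dist p q)"
    by (simp add: nn_integral_add nn_integral_cmult nn_integral_measure_pmf ennreal_tv_dist)
  finally show ?thesis .
qed

section \<open>The transition operator\<close>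

text \<open>The operator K of the overview. It maps functions of a pair to functions of a pair, so
  that its power \<open>^^ i\<close> is the conditional expectation i steps ahead.\<close>

definition transition_op ::
  "('s, 'a::countable) mdp \<Rightarrow> ('s \<Rightarrow> 'a pmf) \<Rightarrow> ('s \<times> 'a \<Rightarrow> ennreal) \<Rightarrow> 's \<times> 'a \<Rightarrow> ennreal" where
  "transition_op D \<pi> f = (\<lambda>(s, a). \<integral>\<^sup>+ y. f y \<partial>step D \<pi> s a)"

lemma space_state_actions: "space (state_actions D) = space (states D) \<times> UNIV"
  by (simp add: state_actions_def space_pair_measure)

lemma borel_measurable_transition_op:
  assumes "is_mdp D" "\<pi> \<in> policies D" "f \<in> borel_measurable (state_actions D)"
  shows "transition_op D \<pi> f \<in> borel_measurable (state_actions D)"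
proof -
  have "(\<lambda>y. \<integral>\<^sup>+ z. f z \<partial>(case y of (s, a) \<Rightarrow> step D \<pi> s a)) \<in> borel_measurable (state_actions D)"
    by (rule measurable_compose[OF measurable_prob_algebraD[OF measurable_step[OF assms(1,2)]]
          nn_integral_measurable_subprob_algebra[OF assms(3)]])
  then show ?thesis
    by (simp add: transition_op_def split_beta')
qed

lemma borel_measurable_transition_op_pow:
  assumes "is_mdp D" "\<pi> \<in> policies D" "f \<in> borel_measurable (state_actions D)"
  shows "(transition_op D \<pi> ^^ i) f \<in> borel_measurable (state_actions D)"
  by (induction i) (auto simp: assms borel_measurable_transition_op)

lemma sets_step:
  assumes "is_mdp D" "\<pi> \<in> policies D" "s \<in> space (states D)"
  shows "sets (step D \<pi> s a) = sets (state_actions D)"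
  using measurable_space[OF measurable_step[OF assms(1,2)], of "(s, a)"] assms(3)
  by (simp add: space_state_actions space_prob_algebra)

lemma sets_trans_kernel:
  assumes "is_mdp D" "s \<in> space (states D)"
  shows "sets (trans_kernel D s a) = sets (states D)"
proof -
  have "(\<lambda>(s, a). trans_kernel D s a) \<in> state_actions D \<rightarrow>\<^sub>M prob_algebra (states D)"
    using assms(1) by (simp add: is_mdp_def)
  from measurable_space[OF this, of "(s, a)"] assms(2) show ?thesis
    by (simp add: space_state_actions space_prob_algebra)
qed

lemma nn_integral_draw_action:
  assumes "s \<in> space (states D)" "f \<in> borel_measurable (state_actions D)"
  shows "(\<integral>\<^sup>+ y. f y \<partial>draw_action D \<pi> s) = (\<integral>\<^sup>+ a. f (s, a) \<partial>\<pi> s)"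
  unfolding draw_action_def using assms
  by (subst nn_integral_distr) (auto simp: space_state_actions)

text \<open>Separates the draw of the next state from that of the next action; the inner integral is
  where two policies can be compared state by state.\<close>

lemma transition_op_eq:
  assumes "is_mdp D" "\<pi> \<in> policies D" "f \<in> borel_measurable (state_actions D)"
    and "s \<in> space (states D)"
  shows "transition_op D \<pi> f (s, a) = (\<integral>\<^sup>+ s'. \<integral>\<^sup>+ a'. f (s', a') \<partial>\<pi> s' \<partial>trans_kernel D s a)"
proof -
  have sets: "sets (trans_kernel D s a) = sets (states D)"
    by (rule sets_trans_kernel) fact+
  have "draw_action D \<pi> \<in> trans_kernel D s a \<rightarrow>\<^sub>M subprob_algebra (state_actions D)"
    using measurable_prob_algebraD[OF measurable_draw_action[OF assms(2)]]
    by (simp add: measurable_cong_sets[OF sets refl])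
  then have "transition_op D \<pi> f (s, a) =
      (\<integral>\<^sup>+ s'. \<integral>\<^sup>+ y. f y \<partial>draw_action D \<pi> s' \<partial>trans_kernel D s a)"
    by (simp add: transition_op_def step_def nn_integral_bind[OF assms(3)])
  also have "\<dots> = (\<integral>\<^sup>+ s'. \<integral>\<^sup>+ a'. f (s', a') \<partial>\<pi> s' \<partial>trans_kernel D s a)"
    using sets_eq_imp_space_eq[OF sets]
    by (intro nn_integral_cong) (simp add: nn_integral_draw_action assms(3))
  finally show ?thesis .
qed

lemma transition_op_mono:
  assumes "is_mdp D" "\<pi> \<in> policies D" "y \<in> space (state_actions D)"
    and "\<And>z. z \<in> space (state_actions D) \<Longrightarrow> f z \<le> g z"
  shows "transition_op D \<pi> f y \<le> transition_op D \<pi> g y"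
  using assms(3) sets_eq_imp_space_eq[OF sets_step[OF assms(1,2)]]
  by (auto simp: transition_op_def space_state_actions intro!: nn_integral_mono assms(4))

lemma transition_op_add:
  assumes "is_mdp D" "\<pi> \<in> policies D" "y \<in> space (state_actions D)"
    and "f \<in> borel_measurable (state_actions D)" "g \<in> borel_measurable (state_actions D)"
  shows "transition_op D \<pi> (\<lambda>z. f z + g z) y = transition_op D \<pi> f y + transition_op D \<pi> g y"
proof -
  obtain s a where "y = (s, a)" "s \<in> space (states D)"
    using assms(3) by (auto simp: space_state_actions)
  moreover from sets_step[OF assms(1,2) this(2)]
  have "f \<in> borel_measurable (step D \<pi> s a)" "g \<in> borel_measurable (step D \<pi> s a)"
    using assms(4,5) by (simp_all cong: measurable_cong_sets)
  ultimately show ?thesis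
    by (simp add: transition_op_def nn_integral_add)
qed

lemma transition_op_weighted_sum:
  assumes "is_mdp D" "\<pi> \<in> policies D" "y \<in> space (state_actions D)"
    and "\<And>i. f i \<in> borel_measurable (state_actions D)"
  shows "transition_op D \<pi> (\<lambda>z. \<Sum>i\<in>I. c i * f i z) y = (\<Sum>i\<in>I. c i * transition_op D \<pi> (f i) y)"
proof -
  obtain s a where "y = (s, a)" "s \<in> space (states D)"
    using assms(3) by (auto simp: space_state_actions)
  moreover from sets_step[OF assms(1,2) this(2)]
  have "f i \<in> borel_measurable (step D \<pi> s a)" for i
    using assms(4)[of i] by (simp cong: measurable_cong_sets)
  ultimately show ?thesis
    by (simp add: transition_op_def nn_integral_sum nn_integral_cmult)
qed

section \<open>Marginals of the path law\<close>

context
  fixes D :: "('s, 'a::countable) mdp" and \<pi> \<mu>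
  assumes mdp: "is_mdp D" and policy: "\<pi> \<in> policies D"
    and init: "\<mu> \<in> space (prob_algebra (state_actions D))"
begin

interpretation IT: Ionescu_Tulcea "path_kernel D \<pi> \<mu>" "\<lambda>_. state_actions D"
  by (rule Ionescu_Tulcea_path_kernel[OF mdp policy init])

lemma undefined_in_empty_PiM: "(\<lambda>_. undefined) \<in> space (PiM {0..<0::nat} (\<lambda>_. state_actions D))"
  by (simp add: space_PiM)

lemma sets_path_law: "sets (path_law D \<pi> \<mu> n) = sets (PiM {0..<Suc n} (\<lambda>_. state_actions D))"
  unfolding path_law_def using IT.sets_C[OF undefined_in_empty_PiM, of "Suc n"] by simp

lemma borel_measurable_path_component:
  assumes "f \<in> borel_measurable (state_actions D)" "i \<le> n"
  shows "(\<lambda>\<omega>. f (\<omega> i)) \<in> borel_measurable (path_law D \<pi> \<mu> n)"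
  unfolding measurable_cong_sets[OF sets_path_law refl]
  using assms(2) by (intro measurable_compose[OF _ assms(1)] measurable_component_singleton) simp

text \<open>The Markov property: the kernel for coordinate n looks only at coordinate n - 1, so
  integrating out the last coordinate of the path replaces f by K f one step earlier.\<close>

lemma nn_integral_Ionescu_Tulcea_component:
  assumes "f \<in> borel_measurable (state_actions D)" "i < n"
  shows "(\<integral>\<^sup>+ \<omega>. f (\<omega> i) \<partial>IT.C 0 n (\<lambda>_. undefined)) = (\<integral>\<^sup>+ y. (transition_op D \<pi> ^^ i) f y \<partial>\<mu>)"
  using assms
proof (induction n arbitrary: f i)
  case 0
  then show ?case by simp
next
  case (Suc n)
  let ?M = "\<lambda>n. PiM {0..<n} (\<lambda>_. state_actions D)"
  let ?C = "\<lambda>n. IT.C 0 n (\<lambda>_. undefined)"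
  have sets: "sets (?C n) = sets (?M n)"
    using IT.sets_C[OF undefined_in_empty_PiM, of n] by simp
  have f_meas: "(\<lambda>\<omega>. f (\<omega> i)) \<in> borel_measurable (?M (Suc n))"
    using Suc.prems(2)
    by (intro measurable_compose[OF _ Suc.prems(1)] measurable_component_singleton) simp
  \<comment> \<open>The law of n + 1 coordinates is that of n coordinates bound with
    \<open>IT.eP n\<close>, which appends a draw from
    \<open>path_kernel D \<pi> \<mu> n\<close>.\<close>
  have "(\<integral>\<^sup>+ \<omega>. f (\<omega> i) \<partial>?C (Suc n)) = (\<integral>\<^sup>+ \<omega>. \<integral>\<^sup>+ \<omega>'. f (\<omega>' i) \<partial>IT.eP n \<omega> \<partial>?C n)"
    using IT.measurable_eP[of n]
    by (simp add: nn_integral_bind[OF f_meas] measurable_cong_sets[OF sets refl])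
  also have "\<dots> = (\<integral>\<^sup>+ \<omega>. \<integral>\<^sup>+ y. f (fun_upd \<omega> n y i) \<partial>path_kernel D \<pi> \<mu> n \<omega> \<partial>?C n)"
    using f_meas by (intro nn_integral_cong IT.nn_integral_eP) (simp_all add: sets_eq_imp_space_eq[OF sets])
  also have "\<dots> = (\<integral>\<^sup>+ y. (transition_op D \<pi> ^^ i) f y \<partial>\<mu>)"
  proof (cases "i < n")
    case True
    \<comment> \<open>Coordinate i is untouched by the appended draw, so the inner integrand is
      constant and the kernel has mass 1.\<close>
    then have "(\<integral>\<^sup>+ \<omega>. \<integral>\<^sup>+ y. f (fun_upd \<omega> n y i) \<partial>path_kernel D \<pi> \<mu> n \<omega> \<partial>?C n) = (\<integral>\<^sup>+ \<omega>. f (\<omega> i) \<partial>?C n)"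
      by (intro nn_integral_cong)
        (simp add: sets_eq_imp_space_eq[OF sets] prob_space.emeasure_space_1[OF IT.prob_space_P])
    with Suc.IH[OF Suc.prems(1) True] show ?thesis by simp
  next
    case False
    with Suc.prems(2) have [simp]: "i = n" by simp
    show ?thesis
    proof (cases n)
      case 0
      then show ?thesis
        by (simp add: path_kernel_def nn_integral_return[OF undefined_in_empty_PiM, simplified])
    next
      case (Suc m)
      have "(\<integral>\<^sup>+ \<omega>. \<integral>\<^sup>+ y. f (fun_upd \<omega> n y i) \<partial>path_kernel D \<pi> \<mu> n \<omega> \<partial>?C n) =
          (\<integral>\<^sup>+ \<omega>. transition_op D \<pi> f (\<omega> m) \<partial>?C n)"
        using Suc by (intro nn_integral_cong) (simp add: path_kernel_def transition_op_def split_beta')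
      \<comment> \<open>The induction hypothesis is used for K f at coordinate m, which is why f is
        generalized.\<close>
      also have "\<dots> = (\<integral>\<^sup>+ y. (transition_op D \<pi> ^^ m) (transition_op D \<pi> f) y \<partial>\<mu>)"
        using Suc Suc.prems(1)
        by (intro Suc.IH borel_measurable_transition_op mdp policy) simp_all
      also have "\<dots> = (\<integral>\<^sup>+ y. (transition_op D \<pi> ^^ i) f y \<partial>\<mu>)"
        using Suc by (simp add: funpow_swap1)
      finally show ?thesis .
    qed
  qed
  finally show ?case .
qed

lemma nn_integral_path_law_component:
  assumes "f \<in> borel_measurable (state_actions D)" "i \<le> n"
  shows "(\<integral>\<^sup>+ \<omega>. f (\<omega> i) \<partial>path_law D \<pi> \<mu> n) = (\<integral>\<^sup>+ y. (transition_op D \<pi> ^^ i) f y \<partial>\<mu>)"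
  unfolding path_law_def
  using assms by (intro nn_integral_Ionescu_Tulcea_component) simp_all

end

section \<open>Threats as sums of iterates\<close>

text \<open>The threat with n steps to go, as a function of the current pair. The exponent is
  \<open>Suc i\<close> because the danger of the current pair is already discounted once.\<close>

definition danger_to_go ::
  "('s, 'a::countable) mdp \<Rightarrow> real \<Rightarrow> ('s \<Rightarrow> 'a pmf) \<Rightarrow> nat \<Rightarrow> 's \<times> 'a \<Rightarrow> ennreal" where
  "danger_to_go D \<beta> \<pi> n y =
     (\<Sum>i<n. ennreal (\<beta> ^ Suc i) * (transition_op D \<pi> ^^ i) (\<lambda>(s, a). ennreal (danger D s a)) y)"

lemma borel_measurable_danger:
  assumes "is_mdp D"
  shows "(\<lambda>(s, a). ennreal (danger D s a)) \<in> borel_measurable (state_actions D)"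
proof -
  have "(\<lambda>(s, a). danger D s a) \<in> borel_measurable (state_actions D)"
    using assms by (simp add: is_mdp_def)
  from measurable_compose[OF this measurable_ennreal] show ?thesis
    by (simp add: split_beta')
qed

lemma borel_measurable_danger_to_go:
  assumes "is_mdp D" "\<pi> \<in> policies D"
  shows "danger_to_go D \<beta> \<pi> n \<in> borel_measurable (state_actions D)"
  unfolding danger_to_go_def[abs_def]
  by (intro borel_measurable_sum borel_measurable_times_ennreal borel_measurable_const
      borel_measurable_transition_op_pow borel_measurable_danger assms)

text \<open>The Bellman recursion: the summand i = 0 is the immediate danger, and linearity of K
  takes one step and one factor \<open>\<beta>\<close> out of all later summands.\<close>

lemma danger_to_go_Suc:
  assumes "is_mdp D" "\<pi> \<in> policies D" "0 \<le> \<beta>" "y \<in> space (state_actions D)"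
  shows "danger_to_go D \<beta> \<pi> (Suc n) y =
    ennreal \<beta> * (ennreal (case_prod (danger D) y) + transition_op D \<pi> (danger_to_go D \<beta> \<pi> n) y)"
proof -
  have "transition_op D \<pi> (danger_to_go D \<beta> \<pi> n) y =
      (\<Sum>i<n. ennreal (\<beta> ^ Suc i) *
        transition_op D \<pi> ((transition_op D \<pi> ^^ i) (\<lambda>(s, a). ennreal (danger D s a))) y)"
    unfolding danger_to_go_def[abs_def]
    by (intro transition_op_weighted_sum borel_measurable_transition_op_pow borel_measurable_danger
        assms)
  then show ?thesis
    using assms(3) unfolding danger_to_go_def sum.lessThan_Suc_shift
    by (simp add: algebra_simps sum_distrib_left split_beta' ennreal_mult)
qed

lemma return_in_prob_algebra:
  "y \<in> space M \<Longrightarrow> return M y \<in> space (prob_algebra M)"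
  by (simp add: space_prob_algebra prob_space_return)

text \<open>By linearity the expectation is a sum over coordinates of the path, and from a point
  mass the expected danger at coordinate i is the i-th iterate of K at the starting pair.\<close>

lemma threat_eq_danger_to_go:
  assumes "is_mdp D" "\<pi> \<in> policies D" "0 \<le> \<beta>" "s \<in> space (states D)" "t \<le> horizon D"
  shows "threat D \<beta> \<pi> t s a = danger_to_go D \<beta> \<pi> (horizon D - t) (s, a)"
proof -
  let ?n = "horizon D - t"
  let ?d = "\<lambda>(s, a). ennreal (danger D s a)"
  let ?L = "path_law D \<pi> (return (state_actions D) (s, a)) ?n"
  have sa: "(s, a) \<in> space (state_actions D)"
    using assms(4) by (simp add: space_state_actions)
  note ctxt = assms(1,2) return_in_prob_algebra[OF sa]
  have "threat D \<beta> \<pi> t s a = (\<integral>\<^sup>+ \<omega>. (\<Sum>i<?n. ennreal (\<beta> ^ Suc i) * ?d (\<omega> i)) \<partial>?L)"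
    unfolding threat_def
  proof (rule nn_integral_cong)
    fix \<omega> assume "\<omega> \<in> space ?L"
    show "(\<Sum>k=t+1..horizon D. ennreal (\<beta> ^ (k - t) * case_prod (danger D) (\<omega> (k - 1 - t)))) =
        (\<Sum>i<?n. ennreal (\<beta> ^ Suc i) * ?d (\<omega> i))"
      \<comment> \<open>With k = t + 1 + i, the discount exponent k - t is \<open>Suc i\<close> and
        the path index k - 1 - t is i.\<close>
      by (rule sum.reindex_bij_witness[of _ "\<lambda>i. Suc i + t" "\<lambda>k. k - 1 - t"])
        (auto simp: assms(3) ennreal_mult' Suc_diff_Suc split_beta' Suc_diff_le)
  qed
  also have "\<dots> = (\<Sum>i<?n. \<integral>\<^sup>+ \<omega>. ennreal (\<beta> ^ Suc i) * ?d (\<omega> i) \<partial>?L)"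
    by (intro nn_integral_sum borel_measurable_times_ennreal borel_measurable_const
        borel_measurable_path_component[OF ctxt] borel_measurable_danger assms) simp
  also have "\<dots> = (\<Sum>i<?n. ennreal (\<beta> ^ Suc i) * (\<integral>\<^sup>+ \<omega>. ?d (\<omega> i) \<partial>?L))"
    by (intro sum.cong refl nn_integral_cmult borel_measurable_path_component[OF ctxt]
        borel_measurable_danger assms) simp
  also have "\<dots> = danger_to_go D \<beta> \<pi> ?n (s, a)"
    unfolding danger_to_go_def
    by (intro sum.cong refl arg_cong2[where f = "(*)"]
        trans[OF nn_integral_path_law_component[OF ctxt] nn_integral_return] sa
        borel_measurable_transition_op_pow borel_measurable_danger assms) simp
  finally show ?thesis .
qed

section \<open>Secure states\<close>

text \<open>A countable union over actions of finite intersections over times of sublevel sets. The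
  threat is first rewritten to \<open>danger_to_go\<close>, which is known to be measurable.\<close>

lemma secure_states_sets:
  assumes "is_mdp D" "\<eta> \<in> policies D" "0 \<le> \<beta>"
  shows "secure_states D \<beta> \<eta> x \<in> sets (states D)"
proof -
  have meas: "(\<lambda>s. danger_to_go D \<beta> \<eta> n (s, a)) \<in> borel_measurable (states D)" for n a
    by (rule measurable_compose[OF _ borel_measurable_danger_to_go[OF assms(1,2)]])
      (simp add: state_actions_def)
  have "secure_states D \<beta> \<eta> x =
      {s \<in> space (states D). \<exists>a. \<forall>t\<in>{0..horizon D}. threat D \<beta> \<eta> t s a \<le> ennreal (x t)}"
    unfolding secure_states_def secure_actions_def ex_in_conv[symmetric] by simp
  also have "\<dots> = {s \<in> space (states D). \<exists>a. \<forall>t\<in>{0..horizon D}.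
      danger_to_go D \<beta> \<eta> (horizon D - t) (s, a) \<le> ennreal (x t)}"
    using threat_eq_danger_to_go[OF assms]
    by (intro Collect_cong conj_cong refl arg_cong[where f = Ex] ext ball_cong) simp
  also have "\<dots> \<in> sets (states D)"
    by (intro sets.sets_Collect_countable_Ex sets.sets_Collect_finite_All borel_measurable_le meas)
      auto
  finally show ?thesis .
qed

text \<open>The positive-part formula makes the distance a parametrized integral over actions. Joint
  measurability of its integrand can be checked one action at a time, since the actions are
  countable.\<close>

lemma borel_measurable_tv_dist:
  fixes D :: "('s, 'a::countable) mdp"
  assumes "\<pi> \<in> policies D" "\<eta> \<in> policies D"
  shows "(\<lambda>s. ennreal (tv_dist (\<pi> s) (\<eta> s))) \<in> borel_measurable (states D)"
proof -
  interpret sigma_finite_measure "count_space (UNIV :: 'a set)"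
    by (rule sigma_finite_measure_count_space)
  have pmf_meas: "(\<lambda>s. pmf (\<nu> s) a) \<in> borel_measurable (states D)" if "\<nu> \<in> policies D" for \<nu> a
  proof -
    have "(\<lambda>s. measure_pmf (\<nu> s)) \<in> states D \<rightarrow>\<^sub>M subprob_algebra (count_space UNIV)"
      using that by (auto simp: policies_def intro: measurable_prob_algebraD)
    from measurable_compose[OF this measurable_measure_subprob_algebra[of "{a}"]]
    show ?thesis by (simp add: pmf.rep_eq)
  qed
  have "(\<lambda>(s, a). ennreal (pmf (\<pi> s) a - pmf (\<eta> s) a))
      \<in> borel_measurable (states D \<Otimes>\<^sub>M count_space UNIV)"
    unfolding split_beta'
    by (rule measurable_compose_countable[where g = snd
            and f = "\<lambda>a y. ennreal (pmf (\<pi> (fst y)) a - pmf (\<eta> (fst y)) a)"])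
      (auto intro!: measurable_compose[OF _ measurable_ennreal] borel_measurable_diff
        measurable_compose[OF measurable_fst pmf_meas] assms)
  from borel_measurable_nn_integral[OF this] show ?thesis
    by (simp add: ennreal_tv_dist)
qed

lemma borel_measurable_secure_deviation_integrand:
  assumes "is_mdp D" "\<eta> \<in> policies D" "\<pi> \<in> policies D" "0 \<le> \<beta>"
  shows "(\<lambda>s. indicator (secure_states D \<beta> \<eta> x) s * ennreal (tv_dist (\<pi> s) (\<eta> s)))
    \<in> borel_measurable (states D)"
  by (intro borel_measurable_times_ennreal borel_measurable_indicator secure_states_sets
      borel_measurable_tv_dist assms)

lemma borel_measurable_secure_deviation:
  assumes "is_mdp D" "\<eta> \<in> policies D" "\<pi> \<in> policies D" "0 \<le> \<beta>"
  shows "case_prod (secure_deviation D \<beta> \<eta> x \<pi>) \<in> borel_measurable (state_actions D)"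
proof -
  have "(\<lambda>(s, a). trans_kernel D s a) \<in> state_actions D \<rightarrow>\<^sub>M prob_algebra (states D)"
    using assms(1) by (simp add: is_mdp_def)
  from measurable_compose[OF measurable_prob_algebraD[OF this]
      nn_integral_measurable_subprob_algebra[OF borel_measurable_secure_deviation_integrand[OF assms]]]
  show ?thesis
    by (simp add: secure_deviation_def split_beta')
qed

section \<open>Comparison of the threats of \<open>\<pi>\<close> and \<open>\<eta>\<close>\<close>

text \<open>The cost of drawing only the next action from \<open>\<pi>\<close> while all later ones
  still come from \<open>\<eta>\<close>. With n steps to go the time is
  \<open>horizon D - n\<close>, which selects the constant x.\<close>

lemma transition_op_secure_policy_le:
  assumes "is_mdp D" "\<eta> \<in> policies D" "\<pi> \<in> secure_policies D \<beta> \<eta> x" "0 \<le> \<beta>"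
    and "y \<in> space (state_actions D)" "n \<le> horizon D"
  shows "transition_op D \<pi> (danger_to_go D \<beta> \<eta> n) y \<le>
    transition_op D \<eta> (danger_to_go D \<beta> \<eta> n) y +
    ennreal (x (horizon D - n)) * case_prod (secure_deviation D \<beta> \<eta> x \<pi>) y"
proof -
  obtain s a where y: "y = (s, a)" and s: "s \<in> space (states D)"
    using assms(5) by (auto simp: space_state_actions)
  have \<pi>: "\<pi> \<in> policies D"
    using assms(3) by (simp add: secure_policies_def)
  let ?t = "horizon D - n"
  let ?G = "danger_to_go D \<beta> \<eta> n"
  let ?z = "\<lambda>s. indicator (secure_states D \<beta> \<eta> x) s * ennreal (tv_dist (\<pi> s) (\<eta> s))"
  have threat: "threat D \<beta> \<eta> ?t s a = ?G (s, a)" if "s \<in> space (states D)" for s a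
    using threat_eq_danger_to_go[OF assms(1,2,4) that, of ?t a] assms(6) by simp
  have G_meas: "?G \<in> borel_measurable (state_actions D)"
    by (intro borel_measurable_danger_to_go assms)
  \<comment> \<open>At a secure next state the support condition bounds the threat by x and the
    total variation estimate applies; at any other state the defining inequality of
    \<open>no_riskier_dists\<close> suffices and the indicator is 0.\<close>
  have pointwise: "(\<integral>\<^sup>+ a. ?G (s, a) \<partial>\<pi> s) \<le> (\<integral>\<^sup>+ a. ?G (s, a) \<partial>\<eta> s) + ennreal (x ?t) * ?z s"
    if s: "s \<in> space (states D)" for s
  proof (cases "s \<in> secure_states D \<beta> \<eta> x")
    case True
    then have "set_pmf (\<pi> s) \<subseteq> secure_actions D \<beta> \<eta> x s"
      using assms(3) by (simp add: secure_policies_def)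
    then have "?G (s, a) \<le> ennreal (x ?t)" if "a \<in> set_pmf (\<pi> s)" for a
      using that by (auto simp: secure_actions_def threat[OF s, symmetric])
    from nn_integral_pmf_le_tv_dist[of "\<pi> s" "\<lambda>a. ?G (s, a)", OF this] True show ?thesis
      by simp
  next
    case False
    with s have "\<pi> s \<in> no_riskier_dists D \<beta> \<eta> s"
      using assms(3) by (simp add: secure_policies_def)
    then have "(\<integral>\<^sup>+ a. threat D \<beta> \<eta> ?t s a \<partial>\<pi> s) \<le> (\<integral>\<^sup>+ a. threat D \<beta> \<eta> ?t s a \<partial>\<eta> s)"
      by (simp add: no_riskier_dists_def)
    then show ?thesis
      using False by (simp add: threat[OF s])
  qed
  have sets: "sets (trans_kernel D s a) = sets (states D)"
    by (rule sets_trans_kernel) fact+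
  have z_meas: "?z \<in> borel_measurable (trans_kernel D s a)"
    unfolding measurable_cong_sets[OF sets refl]
    by (rule borel_measurable_secure_deviation_integrand) (fact assms \<pi>)+
  have "(\<lambda>s. \<integral>\<^sup>+ y. ?G y \<partial>draw_action D \<eta> s) \<in> borel_measurable (states D)"
    by (rule measurable_compose[OF measurable_prob_algebraD[OF measurable_draw_action[OF assms(2)]]
          nn_integral_measurable_subprob_algebra[OF G_meas]])
  then have \<eta>_meas: "(\<lambda>s. \<integral>\<^sup>+ a. ?G (s, a) \<partial>\<eta> s) \<in> borel_measurable (trans_kernel D s a)"
    unfolding measurable_cong_sets[OF sets refl]
    by (rule measurable_cong[THEN iffD1, rotated]) (simp add: nn_integral_draw_action G_meas)
  have "transition_op D \<pi> ?G y = (\<integral>\<^sup>+ s'. \<integral>\<^sup>+ a'. ?G (s', a') \<partial>\<pi> s' \<partial>trans_kernel D s a)"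
    unfolding y by (rule transition_op_eq) (fact assms \<pi> G_meas s)+
  also have "\<dots> \<le> (\<integral>\<^sup>+ s'. (\<integral>\<^sup>+ a'. ?G (s', a') \<partial>\<eta> s') + ennreal (x ?t) * ?z s' \<partial>trans_kernel D s a)"
    by (intro nn_integral_mono pointwise) (simp add: sets_eq_imp_space_eq[OF sets])
  also have "\<dots> = transition_op D \<eta> ?G y + ennreal (x ?t) * case_prod (secure_deviation D \<beta> \<eta> x \<pi>) y"
    using z_meas \<eta>_meas
    by (simp add: y nn_integral_add nn_integral_cmult secure_deviation_def
        transition_op_eq[OF assms(1,2) G_meas s])
  finally show ?thesis .
qed

text \<open>Term k is the error of the action drawn k + 1 steps ahead, seen from the pair k steps
  ahead. There are only n - 1 terms because after n steps nothing remains to go, so the last draw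
  causes no error.\<close>

lemma danger_to_go_secure_policy_le:
  assumes "is_mdp D" "\<eta> \<in> policies D" "\<pi> \<in> secure_policies D \<beta> \<eta> x" "0 \<le> \<beta>"
    and "y \<in> space (state_actions D)" "n \<le> horizon D"
  shows "danger_to_go D \<beta> \<pi> n y \<le> danger_to_go D \<beta> \<eta> n y +
    (\<Sum>k<n-1. ennreal (\<beta> ^ Suc k * x (horizon D - n + Suc k)) *
       (transition_op D \<pi> ^^ k) (case_prod (secure_deviation D \<beta> \<eta> x \<pi>)) y)"
  using assms(5,6)
proof (induction n arbitrary: y)
  case 0
  then show ?case by (simp add: danger_to_go_def)
next
  case (Suc n)
  have \<pi>: "\<pi> \<in> policies D"
    using assms(3) by (simp add: secure_policies_def)
  show ?case
  \<comment> \<open>With one step to go both threats are just the discounted immediate danger.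
    Otherwise n - 1 is m.\<close>
  proof (cases n)
    case 0
    with Suc.prems show ?thesis
      by (simp add: danger_to_go_def)
  next
    case (Suc m)
    let ?K = "transition_op D \<pi>"
    let ?z = "case_prod (secure_deviation D \<beta> \<eta> x \<pi>)"
    let ?d = "ennreal (case_prod (danger D) y)"
    let ?c = "\<lambda>k. ennreal (\<beta> ^ Suc k * x (horizon D - n + Suc k))"
    have z_meas: "(?K ^^ k) ?z \<in> borel_measurable (state_actions D)" for k
      by (intro borel_measurable_transition_op_pow borel_measurable_secure_deviation assms \<pi>)
    \<comment> \<open>The induction hypothesis is applied under K of \<open>\<pi>\<close>, raising
      every iterate in the error sum by one.\<close>
    have "?K (danger_to_go D \<beta> \<pi> n) y \<le>
        ?K (\<lambda>y. danger_to_go D \<beta> \<eta> n y + (\<Sum>k<m. ?c k * (?K ^^ k) ?z y)) y"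
      using Suc.IH Suc.prems Suc by (intro transition_op_mono assms(1) \<pi>) simp_all
    also have "\<dots> = ?K (danger_to_go D \<beta> \<eta> n) y + (\<Sum>k<m. ?c k * (?K ^^ Suc k) ?z y)"
      using Suc.prems z_meas
      by (simp add: transition_op_add transition_op_weighted_sum assms(1,2) \<pi>
          borel_measurable_danger_to_go)
    \<comment> \<open>Changing the policy of the first transition creates the new error
      term.\<close>
    also have "?K (danger_to_go D \<beta> \<eta> n) y \<le>
        transition_op D \<eta> (danger_to_go D \<beta> \<eta> n) y + ennreal (x (horizon D - n)) * ?z y"
      using Suc.prems by (intro transition_op_secure_policy_le assms) simp_all
    finally have "ennreal \<beta> * (?d + ?K (danger_to_go D \<beta> \<pi> n) y) \<le>
        ennreal \<beta> * (?d + (transition_op D \<eta> (danger_to_go D \<beta> \<eta> n) y +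
          ennreal (x (horizon D - n)) * ?z y + (\<Sum>k<m. ?c k * (?K ^^ Suc k) ?z y)))"
      by (auto intro!: mult_left_mono add_left_mono simp: add_right_mono)
    also have "\<dots> = ennreal \<beta> * (?d + transition_op D \<eta> (danger_to_go D \<beta> \<eta> n) y) +
        (ennreal (\<beta> * x (horizon D - n)) * ?z y +
          (\<Sum>k<m. ennreal (\<beta> * (\<beta> ^ Suc k * x (horizon D - n + Suc k))) * (?K ^^ Suc k) ?z y))"
      using assms(4) by (simp add: algebra_simps sum_distrib_left ennreal_mult' del: funpow.simps)
    \<comment> \<open>The new error becomes the term k = 0 and the old ones shift up by one; since
      \<open>Suc n \<le> horizon D\<close>, \<open>horizon D - n\<close> equals
      \<open>horizon D - Suc n + 1\<close>, so the indices of x agree.\<close>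
    also have "\<dots> = danger_to_go D \<beta> \<eta> (Suc n) y +
        (\<Sum>k<n. ennreal (\<beta> ^ Suc k * x (horizon D - Suc n + Suc k)) * (?K ^^ k) ?z y)"
      using Suc.prems assms(1,2,4)
      by (simp add: danger_to_go_Suc Suc sum.lessThan_Suc_shift Suc_diff_Suc mult.assoc
          del: sum.lessThan_Suc)
    finally show ?thesis
      using Suc.prems assms(1,4) \<pi> by (simp add: danger_to_go_Suc)
  qed
qed

theorem theorem1:
  fixes D :: "('s, 'a::countable) mdp"
    and \<beta> :: real
    and x :: "nat \<Rightarrow> real"
    and \<eta> \<pi> :: "'s \<Rightarrow> 'a pmf"
    and s\<^sub>0 :: 's
  assumes "is_mdp D"
    and "0 \<le> \<beta>" and "\<beta> < 1"
    and "\<forall>t\<in>{0..horizon D}. 0 \<le> x t"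
    and "\<eta> \<in> policies D"
    and "\<pi> \<in> secure_policies D \<beta> \<eta> x"
    and "s\<^sub>0 \<in> space (states D)"
    and "\<forall>a. threat D \<beta> \<eta> 0 s\<^sub>0 a \<le> ennreal (x 0)"
  shows "initial_threat D \<beta> \<pi> s\<^sub>0 \<le>
    ennreal (x 0) +
    (\<Sum>t=1..horizon D - 1. ennreal (\<beta> ^ t * x t) *
       (\<integral>\<^sup>+ \<omega>. case_prod (secure_deviation D \<beta> \<eta> x \<pi>) (\<omega> (t - 1))
          \<partial>path_law D \<pi> (draw_action D \<pi> s\<^sub>0) (horizon D)))"
proof -
  have \<pi>: "\<pi> \<in> policies D"
    using assms(6) by (simp add: secure_policies_def)
  let ?T = "horizon D"
  let ?z = "case_prod (secure_deviation D \<beta> \<eta> x \<pi>)"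
  let ?zk = "\<lambda>k. (transition_op D \<pi> ^^ k) ?z"
  let ?c = "\<lambda>k. ennreal (\<beta> ^ Suc k * x (Suc k))"
  have z_meas: "?z \<in> borel_measurable (state_actions D)"
    by (intro borel_measurable_secure_deviation assms \<pi>)
  have zk_meas: "?zk k \<in> borel_measurable (state_actions D)" for k
    by (intro borel_measurable_transition_op_pow z_meas assms \<pi>)
  have init: "draw_action D \<pi> s\<^sub>0 \<in> space (prob_algebra (state_actions D))"
    by (rule measurable_space[OF measurable_draw_action[OF \<pi>]]) fact
  \<comment> \<open>The comparison is taken with the full horizon to go, where
    \<open>horizon D - n\<close> is 0 and the constants become \<open>x (Suc k)\<close>.\<close>
  have bound: "threat D \<beta> \<pi> 0 s\<^sub>0 a \<le> ennreal (x 0) + (\<Sum>k<?T-1. ?c k * ?zk k (s\<^sub>0, a))" for a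
  proof -
    have "threat D \<beta> \<pi> 0 s\<^sub>0 a \<le> threat D \<beta> \<eta> 0 s\<^sub>0 a + (\<Sum>k<?T-1. ?c k * ?zk k (s\<^sub>0, a))"
      using danger_to_go_secure_policy_le[OF assms(1,5,6,2), of "(s\<^sub>0, a)" ?T] assms(7)
      by (simp add: threat_eq_danger_to_go assms(1,2,5) \<pi> space_state_actions)
    also have "threat D \<beta> \<eta> 0 s\<^sub>0 a \<le> ennreal (x 0)"
      using assms(8) by simp
    finally show ?thesis
      by (simp add: add_right_mono)
  qed
  have "initial_threat D \<beta> \<pi> s\<^sub>0 \<le>
      (\<integral>\<^sup>+ a. ennreal (x 0) + (\<Sum>k<?T-1. ?c k * ?zk k (s\<^sub>0, a)) \<partial>\<pi> s\<^sub>0)"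
    unfolding initial_threat_def by (intro nn_integral_mono bound)
  also have "\<dots> = ennreal (x 0) + (\<Sum>k<?T-1. ?c k * (\<integral>\<^sup>+ a. ?zk k (s\<^sub>0, a) \<partial>\<pi> s\<^sub>0))"
    by (simp add: nn_integral_add nn_integral_sum nn_integral_cmult
        measure_pmf.emeasure_space_1[simplified])
  \<comment> \<open>Averaging the k-th iterate over the first action is integrating it against the
    initial law of the path, hence gives the expectation of z at coordinate k.\<close>
  also have "(\<Sum>k<?T-1. ?c k * (\<integral>\<^sup>+ a. ?zk k (s\<^sub>0, a) \<partial>\<pi> s\<^sub>0)) =
      (\<Sum>k<?T-1. ?c k * (\<integral>\<^sup>+ \<omega>. ?z (\<omega> k) \<partial>path_law D \<pi> (draw_action D \<pi> s\<^sub>0) ?T))"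
    by (intro sum.cong refl)
      (simp add: nn_integral_path_law_component[OF assms(1) \<pi> init z_meas]
        nn_integral_draw_action[OF assms(7) zk_meas])
  also have "\<dots> = (\<Sum>t=1..?T-1. ennreal (\<beta> ^ t * x t) *
      (\<integral>\<^sup>+ \<omega>. ?z (\<omega> (t - 1)) \<partial>path_law D \<pi> (draw_action D \<pi> s\<^sub>0) ?T))"
    \<comment> \<open>Here t is \<open>Suc k\<close>: the deviation at time t is read off the pair
      of time t - 1.\<close>
    by (rule sum.reindex_bij_witness[of _ "\<lambda>t. t - 1" Suc]) auto
  finally show ?thesis .
qed

end
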